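(* Let $k=k(n)=\Omega(n\log n)$. Then the one-sided $k$-transposition shuffle $P_{n,k}$ on $S_n$ mixes in order $n$ steps without cutoff: for every fixed $\varepsilon\in(0,1)$, $t_{\mathrm{mix}}(\varepsilon)=\Theta(n)$ as $n\to\infty$, and $P_{n,k}$ does not exhibit (total variation) cutoff.
   Context: For $1\le i_1,\dots,i_k\le j\le n$ write $(j;i_1,\dots,i_k):=(j\,i_k)\cdots(j\,i_1)\in S_n$, where $(j\,j)$ is the identity. The one-sided $k$-transposition shuffle is the random walk on $S_n$ driven by the probability distribution $$P_{n,k}(\tau)=\sum_{\substack{1\le i_1,\dots,i_k\le j\le n\\ \tau=(j;i_1,\dots,i_k)}}\frac{1}{nj^k};$$ its transition matrix, also denoted $P_{n,k}$, is $P_{n,k}(x,x\tau)=P_{n,k}(\tau)$. With $U$ the uniform measure on $S_n$, $d^{(n,k)}(t)=\frac12\sum_{y\in S_n}|P_{n,k}^t(\mathrm{id},y)-U(y)|$ and $t_{\mathrm{mix}}(\varepsilon)=\min\{t:d^{(n,k)}(t)\le\varepsilon\}$. $P_{n,k}$ exhibits cutoff if there are times $t_{n,k}$ and windows $w_{n,k}=o(t_{n,k})$ such that $$\lim_{c\to\infty}\lim_{n\to\infty}d^{(n,k)}(t_{n,k}-cw_{n,k})=1\quad\text{and}\quad\lim_{c\to\infty}\lim_{n\to\infty}d^{(n,k)}(t_{n,k}+cw_{n,k})=0$$ (non-integer times being rounded to integers). $\log$ is the natural logarithm. *)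

theory Defs
  imports Complex_Main "HOL-Combinatorics.Permutations" "HOL-Library.Landau_Symbols"
begin

definition sym_perms :: "nat \<Rightarrow> (nat \<Rightarrow> nat) set" where
  "sym_perms n = {p. p permutes {1..n}}"

(* For xs = [i_1, ..., i_k] this is (j i_k) o ... o (j i_1): permutations multiply as functions,
   so (j i_1) acts first. Note that transpose j j = id. *)
definition one_sided_prod :: "nat \<Rightarrow> nat list \<Rightarrow> (nat \<Rightarrow> nat)" where
  "one_sided_prod j xs = fold (\<lambda>i p. Transposition.transpose j i \<circ> p) xs id"

definition shuffle_prob :: "nat \<Rightarrow> nat \<Rightarrow> (nat \<Rightarrow> nat) \<Rightarrow> real" where
  "shuffle_prob n k \<tau> =
     (\<Sum>(j, xs) \<in> {(j, xs). j \<in> {1..n} \<and> length xs = k \<and> set xs \<subseteq> {1..j} \<and> \<tau> = one_sided_prod j xs}.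
        1 / (real n * real j ^ k))"

(* P(x, x \<tau>) = P(\<tau>), i.e. P(x, y) = P(x^{-1} y). *)
definition shuffle_matrix :: "nat \<Rightarrow> nat \<Rightarrow> (nat \<Rightarrow> nat) \<Rightarrow> (nat \<Rightarrow> nat) \<Rightarrow> real" where
  "shuffle_matrix n k x y = shuffle_prob n k (inv x \<circ> y)"

primrec matrix_power_on :: "'a set \<Rightarrow> ('a \<Rightarrow> 'a \<Rightarrow> real) \<Rightarrow> nat \<Rightarrow> 'a \<Rightarrow> 'a \<Rightarrow> real" where
  "matrix_power_on S P 0 x y = (if x = y then 1 else 0)"
| "matrix_power_on S P (Suc t) x y = (\<Sum>z\<in>S. matrix_power_on S P t x z * P z y)"

definition tv_dist :: "nat \<Rightarrow> nat \<Rightarrow> nat \<Rightarrow> real" where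
  "tv_dist n k t =
     1/2 * (\<Sum>y\<in>sym_perms n.
       \<bar>matrix_power_on (sym_perms n) (shuffle_matrix n k) t id y - 1 / real (card (sym_perms n))\<bar>)"

definition t_mix :: "nat \<Rightarrow> nat \<Rightarrow> real \<Rightarrow> nat" where
  "t_mix n k \<epsilon> = (LEAST t. tv_dist n k t \<le> \<epsilon>)"

(* d n t is the distance to stationarity of the n-th chain at time t. Real times are rounded to the
   nearest integer. The iterated limits are read as: the inner limits in n exist for all
   sufficiently large c, and define functions of c with the required limits. *)
definition exhibits_cutoff :: "(nat \<Rightarrow> nat \<Rightarrow> real) \<Rightarrow> bool" where
  "exhibits_cutoff d \<longleftrightarrow>
     (\<exists>(t :: nat \<Rightarrow> real) (w :: nat \<Rightarrow> real).
        (\<forall>n. t n \<ge> 0) \<and> (\<forall>n. w n \<ge> 0) \<and> w \<in> o(t) \<and>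
        (\<exists>f :: real \<Rightarrow> real.
           (\<forall>\<^sub>F c in at_top. (\<lambda>n. d n (nat (round (t n - c * w n)))) \<longlonglongrightarrow> f c) \<and>
           (f \<longlongrightarrow> 1) at_top) \<and>
        (\<exists>g :: real \<Rightarrow> real.
           (\<forall>\<^sub>F c in at_top. (\<lambda>n. d n (nat (round (t n + c * w n)))) \<longlonglongrightarrow> g c) \<and>
           (g \<longlongrightarrow> 0) at_top))"

end

theory Submission
  imports Defs
begin

text \<open>
  Conditionally on the top position \<open>j\<close>, a shuffle step convolves with the \<open>k\<close>-th power of
  the star transposition measure on \<open>S\<^sub>j\<close>, which is \<open>(1 + J\<^sub>j) / j\<close> for the Jucys--Murphy
  element \<open>J\<^sub>j\<close>. These elements commute, so all steps with top position \<open>n\<close> may be performed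
  first: if there are \<open>l\<close> of them, the distance to uniformity is at most that of the star
  transposition walk on \<open>S\<^sub>n\<close> after \<open>k l\<close> steps. This walk has a strong stationary time with
  expectation at most \<open>2 n (1 + log n)\<close>: if the permutation is uniform on a left coset of the
  symmetric group of a set containing \<open>n\<close>, then after a transposition \<open>(n i)\<close> with \<open>i\<close> outside
  the set it is uniform on a coset for a set of the same size avoiding \<open>n\<close>, and as soon as
  \<open>i\<close> lies in the latter set or equals \<open>n\<close>, a Fisher--Yates step adds \<open>n\<close> to it. As \<open>l\<close> is
  binomial with mean \<open>t / n\<close> and \<open>k\<close> is at least of order \<open>n log n\<close>, the distance at time \<open>t\<close>
  is \<open>O(1 / (1 + t / n))\<close>. On the other hand, \<open>n\<close> has not been moved with probability at
  least \<open>(1 - 1 / n) ^ t\<close>, so that the distance is at least about \<open>exp (- 2 t / n)\<close>.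
\<close>

section \<open>Commuting averages over star transpositions\<close>

definition star_avg :: "nat \<Rightarrow> ((nat \<Rightarrow> nat) \<Rightarrow> real) \<Rightarrow> (nat \<Rightarrow> nat) \<Rightarrow> real" where
  "star_avg j f y = (\<Sum>i\<in>{1..j}. f (y \<circ> transpose j i)) / real j"

definition shuffle_step :: "nat \<Rightarrow> nat \<Rightarrow> ((nat \<Rightarrow> nat) \<Rightarrow> real) \<Rightarrow> (nat \<Rightarrow> nat) \<Rightarrow> real" where
  "shuffle_step n k f y = (\<Sum>j\<in>{1..n}. (star_avg j ^^ k) f y) / real n"

definition point_mass :: "'a \<Rightarrow> 'a \<Rightarrow> real" where
  "point_mass x y = (if y = x then 1 else 0)"

text \<open>The shape with weights and a common divisor fits both mixtures used later: a shuffle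
  step, and the first star step from a coset, each with weights \<open>1\<close> and divisor
  \<open>n\<close>.\<close>

lemma star_avg_linear:
  "star_avg j (\<lambda>y. (\<Sum>i\<in>I. a i * g i y) / c) = (\<lambda>y. (\<Sum>i\<in>I. a i * star_avg j (g i) y) / c)"
proof
  fix y
  have "star_avg j (\<lambda>y. (\<Sum>i\<in>I. a i * g i y) / c) y =
      (\<Sum>m\<in>{1..j}. \<Sum>i\<in>I. a i * g i (y \<circ> transpose j m)) / c / real j"
    by (simp add: star_avg_def sum_divide_distrib)
  also have "\<dots> = (\<Sum>i\<in>I. \<Sum>m\<in>{1..j}. a i * g i (y \<circ> transpose j m)) / c / real j"
    by (subst sum.swap) simp
  also have "\<dots> = (\<Sum>i\<in>I. a i * star_avg j (g i) y) / c"
    by (simp add: star_avg_def sum_distrib_left sum_divide_distrib mult.commute)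
  finally show "star_avg j (\<lambda>y. (\<Sum>i\<in>I. a i * g i y) / c) y = (\<Sum>i\<in>I. a i * star_avg j (g i) y) / c" .
qed

lemma star_avg_power_linear:
  "(star_avg j ^^ r) (\<lambda>y. (\<Sum>i\<in>I. a i * g i y) / c)
    = (\<lambda>y. (\<Sum>i\<in>I. a i * (star_avg j ^^ r) (g i) y) / c)"
  by (induction r) (simp_all add: star_avg_linear)

text \<open>Conjugation by \<open>(l m)\<close> relabels only \<open>i\<close>, because
  \<open>m \<le> l < j\<close> leaves \<open>j\<close> fixed.\<close>

lemma transpose_comp_transpose:
  fixes l m j :: nat
  assumes "l < j" "m \<le> l"
  shows "transpose l m \<circ> transpose j i = transpose j (transpose l m i) \<circ> transpose l m"
proof -
  have "l \<noteq> j" "m \<noteq> j" using assms by auto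
  then show ?thesis by (intro ext) (auto simp: transpose_def)
qed

text \<open>Conjugation by \<open>(l m)\<close> merely permutes the transpositions
  \<open>(j i)\<close> with \<open>i \<le> j\<close>, so their sum commutes with every
  \<open>(l m)\<close>.\<close>

lemma star_avg_commute_less:
  assumes "l < j"
  shows "star_avg l (star_avg j f) = star_avg j (star_avg l f)"
proof
  fix y
  have inner: "(\<Sum>i\<in>{1..j}. f (y \<circ> transpose l m \<circ> transpose j i))
      = (\<Sum>i\<in>{1..j}. f (y \<circ> transpose j i \<circ> transpose l m))" if m: "m \<in> {1..l}" for m
  proof -
    have "transpose l m permutes {1..j}" using m assms by (intro permutes_swap_id) auto
    then have "(\<Sum>i\<in>{1..j}. f (y \<circ> transpose j i \<circ> transpose l m))
      = (\<Sum>i\<in>{1..j}. f (y \<circ> transpose j (transpose l m i) \<circ> transpose l m))"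
      by (subst sum.permute) (auto simp: o_def)
    also have "\<dots> = (\<Sum>i\<in>{1..j}. f (y \<circ> transpose l m \<circ> transpose j i))"
      using transpose_comp_transpose[OF assms] m by (simp add: comp_assoc)
    finally show ?thesis ..
  qed
  have "star_avg l (star_avg j f) y
      = (\<Sum>m\<in>{1..l}. \<Sum>i\<in>{1..j}. f (y \<circ> transpose l m \<circ> transpose j i)) / real j / real l"
    by (simp add: star_avg_def sum_divide_distrib)
  also have "\<dots> = (\<Sum>m\<in>{1..l}. \<Sum>i\<in>{1..j}. f (y \<circ> transpose j i \<circ> transpose l m)) / real j / real l"
    using inner by simp
  also have "\<dots> = (\<Sum>i\<in>{1..j}. \<Sum>m\<in>{1..l}. f (y \<circ> transpose j i \<circ> transpose l m)) / real j / real l"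
    by (subst sum.swap) simp
  also have "\<dots> = star_avg j (star_avg l f) y"
    by (simp add: star_avg_def sum_divide_distrib divide_divide_eq_left mult.commute)
  finally show "star_avg l (star_avg j f) y = star_avg j (star_avg l f) y" .
qed

lemma star_avg_commute: "star_avg l (star_avg j f) = star_avg j (star_avg l f)"
  using star_avg_commute_less[of l j f] star_avg_commute_less[of j l f]
  by (cases l j rule: linorder_cases) auto

lemma star_avg_power_commute: "star_avg l ((star_avg j ^^ k) f) = (star_avg j ^^ k) (star_avg l f)"
  by (induction k) (simp_all add: star_avg_commute)

lemma star_avg_shuffle_step: "star_avg l (shuffle_step n k f) = shuffle_step n k (star_avg l f)"
proof -
  have e: "shuffle_step n k f = (\<lambda>y. (\<Sum>j\<in>{1..n}. 1 * (star_avg j ^^ k) f y) / real n)" for f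
    by (simp add: shuffle_step_def fun_eq_iff)
  show ?thesis unfolding e star_avg_linear star_avg_power_commute ..
qed

text \<open>This is what moves the steps with top position \<open>n\<close> to the front.\<close>

lemma star_avg_power_shuffle_step_power:
  "(star_avg l ^^ r) ((shuffle_step n k ^^ t) f) = (shuffle_step n k ^^ t) ((star_avg l ^^ r) f)"
proof (induction r)
  case (Suc r)
  have "star_avg l ((shuffle_step n k ^^ t) g) = (shuffle_step n k ^^ t) (star_avg l g)" for g
    by (induction t) (simp_all add: star_avg_shuffle_step)
  with Suc show ?case by simp
qed simp

section \<open>Positivity and conservation of mass\<close>

lemma star_avg_ge:
  assumes "j \<in> {1..n}" "\<And>y. y permutes {1..n} \<Longrightarrow> a \<le> f y" "y permutes {1..n}"
  shows "a \<le> star_avg j f y"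
proof -
  have "real j * a = (\<Sum>i\<in>{1..j}. a)" by simp
  also have "\<dots> \<le> (\<Sum>i\<in>{1..j}. f (y \<circ> transpose j i))"
    using assms by (intro sum_mono assms(2) permutes_compose[OF permutes_swap_id]) auto
  finally show ?thesis using assms(1) by (simp add: star_avg_def field_simps)
qed

text \<open>With \<open>a = 0\<close> this is positivity; with a general \<open>a\<close> it says
  that further averaging never destroys a minorisation.\<close>

lemma star_avg_power_ge:
  assumes "j \<in> {1..n}" "\<And>y. y permutes {1..n} \<Longrightarrow> a \<le> f y" "y permutes {1..n}"
  shows "a \<le> (star_avg j ^^ r) f y"
  using assms(3)
proof (induction r arbitrary: y)
  case (Suc r)
  then show ?case using star_avg_ge[OF assms(1), of a "(star_avg j ^^ r) f" y] by simp
qed (simp add: assms(2))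

lemma shuffle_step_power_nonneg:
  assumes "n \<ge> 1" "\<And>y. y permutes {1..n} \<Longrightarrow> 0 \<le> f y" "y permutes {1..n}"
  shows "0 \<le> (shuffle_step n k ^^ t) f y"
  using assms(3)
proof (induction t arbitrary: y)
  case (Suc t)
  have "0 \<le> (star_avg j ^^ k) ((shuffle_step n k ^^ t) f) y" if "j \<in> {1..n}" for j
    using star_avg_power_ge[OF that, of 0 "(shuffle_step n k ^^ t) f"] Suc by simp
  then have "0 \<le> (\<Sum>j\<in>{1..n}. (star_avg j ^^ k) ((shuffle_step n k ^^ t) f) y)"
    by (rule sum_nonneg)
  then show ?case by (simp add: shuffle_step_def[of n k "(shuffle_step n k ^^ t) f"])
qed (simp add: assms(2))

text \<open>Right multiplication by each transposition is an involution of \<open>A\<close>, so it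
  only reorders the sum. Besides the whole group, \<open>A\<close> will be the stabiliser of
  \<open>n\<close>, which is invariant when \<open>j < n\<close>.\<close>

lemma sum_star_avg:
  assumes "j \<ge> 1" "\<And>i y. i \<in> {1..j} \<Longrightarrow> y \<in> A \<Longrightarrow> y \<circ> transpose j i \<in> A"
  shows "(\<Sum>y\<in>A. star_avg j f y) = (\<Sum>y\<in>A. f y)"
proof -
  have "(\<Sum>y\<in>A. f (y \<circ> transpose j i)) = (\<Sum>y\<in>A. f y)" if "i \<in> {1..j}" for i
    by (rule sum.reindex_bij_witness[where i = "\<lambda>y. y \<circ> transpose j i" and j = "\<lambda>y. y \<circ> transpose j i"])
      (use that assms(2) in \<open>auto simp: comp_assoc\<close>)
  then have "(\<Sum>i\<in>{1..j}. \<Sum>y\<in>A. f (y \<circ> transpose j i)) = real j * (\<Sum>y\<in>A. f y)" by simp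
  then show ?thesis using assms(1)
    by (simp add: star_avg_def flip: sum_divide_distrib) (subst sum.swap, simp)
qed

lemma sum_star_avg_power:
  assumes "j \<ge> 1" "\<And>i y. i \<in> {1..j} \<Longrightarrow> y \<in> A \<Longrightarrow> y \<circ> transpose j i \<in> A"
  shows "(\<Sum>y\<in>A. (star_avg j ^^ r) f y) = (\<Sum>y\<in>A. f y)"
proof (induction r)
  case (Suc r)
  then show ?case using sum_star_avg[OF assms, of "(star_avg j ^^ r) f"] by simp
qed simp

lemma sum_shuffle_step_power:
  assumes "n \<ge> 1"
  shows "(\<Sum>y\<in>sym_perms n. (shuffle_step n k ^^ t) f y) = (\<Sum>y\<in>sym_perms n. f y)"
proof (induction t)
  case (Suc t)
  have "(\<Sum>y\<in>sym_perms n. (star_avg j ^^ k) ((shuffle_step n k ^^ t) f) y) = (\<Sum>y\<in>sym_perms n. f y)"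
    if "j \<in> {1..n}" for j
    by (subst sum_star_avg_power)
      (use that Suc in \<open>auto simp: sym_perms_def intro!: permutes_compose[OF permutes_swap_id]\<close>)
  then have "(\<Sum>j\<in>{1..n}. \<Sum>y\<in>sym_perms n. (star_avg j ^^ k) ((shuffle_step n k ^^ t) f) y)
      = real n * (\<Sum>y\<in>sym_perms n. f y)" by simp
  then show ?case using assms
    by (simp add: shuffle_step_def[of n k "(shuffle_step n k ^^ t) f"] flip: sum_divide_distrib)
      (subst sum.swap, simp)
qed simp

text \<open>Top positions \<open>j < n\<close> preserve the mass of the stabiliser of
  \<open>n\<close>, and \<open>j = n\<close> contributes something nonnegative, so each step keeps
  at least the fraction \<open>1 - 1 / n\<close>.\<close>

lemma sum_fixing_shuffle_step_power_ge:
  assumes "n \<ge> 1" "\<And>y. y permutes {1..n} \<Longrightarrow> 0 \<le> f y"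
  defines "A \<equiv> {y \<in> sym_perms n. y n = n}"
  shows "(1 - 1 / real n) ^ t * (\<Sum>y\<in>A. f y) \<le> (\<Sum>y\<in>A. (shuffle_step n k ^^ t) f y)"
proof (induction t)
  case (Suc t)
  let ?g = "(shuffle_step n k ^^ t) f"
  have low: "(\<Sum>y\<in>A. (star_avg j ^^ k) ?g y) = (\<Sum>y\<in>A. ?g y)" if "j \<in> {1..<n}" for j
    by (rule sum_star_avg_power)
      (use that in \<open>auto simp: A_def sym_perms_def transpose_def
        intro!: permutes_compose[OF permutes_swap_id]\<close>)
  have top: "0 \<le> (\<Sum>y\<in>A. (star_avg n ^^ k) ?g y)"
    using assms(1,2) by (intro sum_nonneg star_avg_power_ge[where n = n] shuffle_step_power_nonneg)
      (auto simp: A_def sym_perms_def)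
  have "{1..n} = insert n {1..<n}" using assms(1) by auto
  then have "(\<Sum>j\<in>{1..n}. \<Sum>y\<in>A. (star_avg j ^^ k) ?g y)
      = (\<Sum>y\<in>A. (star_avg n ^^ k) ?g y) + (\<Sum>j\<in>{1..<n}. \<Sum>y\<in>A. (star_avg j ^^ k) ?g y)" by simp
  also have "(\<Sum>j\<in>{1..<n}. \<Sum>y\<in>A. (star_avg j ^^ k) ?g y) = (real n - 1) * (\<Sum>y\<in>A. ?g y)"
    using low assms(1) by (simp add: of_nat_diff)
  finally have "(real n - 1) * (\<Sum>y\<in>A. ?g y) \<le> (\<Sum>j\<in>{1..n}. \<Sum>y\<in>A. (star_avg j ^^ k) ?g y)"
    using top by simp
  also have "\<dots> = real n * (\<Sum>y\<in>A. (shuffle_step n k ^^ Suc t) f y)"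
    using assms(1)
    by (simp add: shuffle_step_def[of n k ?g] flip: sum_divide_distrib) (subst sum.swap, simp)
  finally have *: "(1 - 1 / real n) * (\<Sum>y\<in>A. ?g y) \<le> (\<Sum>y\<in>A. (shuffle_step n k ^^ Suc t) f y)"
    using assms(1) by (simp add: field_simps)
  have "(1 - 1 / real n) ^ Suc t * (\<Sum>y\<in>A. f y) = (1 - 1 / real n) * ((1 - 1 / real n) ^ t * (\<Sum>y\<in>A. f y))"
    by simp
  also have "\<dots> \<le> (1 - 1 / real n) * (\<Sum>y\<in>A. ?g y)"
    using Suc assms(1) by (intro mult_left_mono) auto
  finally show ?case using * by linarith
qed simp

section \<open>Agreement with the transition matrix\<close>

lemma one_sided_prod_Cons: "one_sided_prod j (i # xs) = one_sided_prod j xs \<circ> transpose j i"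
proof -
  have "fold (\<lambda>i p. transpose j i \<circ> p) xs q = fold (\<lambda>i p. transpose j i \<circ> p) xs id \<circ> q" for q :: "nat \<Rightarrow> nat"
  proof (induction xs arbitrary: q)
    case (Cons a xs)
    show ?case
      using Cons[of "transpose j a \<circ> q"] Cons[of "transpose j a"] by (simp add: comp_assoc)
  qed simp
  from this[of "transpose j i"] show ?thesis by (simp add: one_sided_prod_def)
qed

lemma one_sided_prod_permutes:
  assumes "set xs \<subseteq> {1..j}" "j \<in> {1..n}"
  shows "one_sided_prod j xs permutes {1..n}"
  using assms
proof (induction xs)
  case Nil
  then show ?case using permutes_id by (simp add: one_sided_prod_def id_def)
next
  case (Cons a xs)
  then show ?case unfolding one_sided_prod_Cons
    by (intro permutes_compose[OF permutes_swap_id]) auto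
qed

text \<open>Averaging looks up the density at predecessors of \<open>y\<close>, which is why the
  inverse of the product appears.\<close>

lemma star_avg_power_eq:
  assumes "j \<ge> 1"
  shows "(star_avg j ^^ k) f y =
    (\<Sum>xs | set xs \<subseteq> {1..j} \<and> length xs = k. f (y \<circ> inv (one_sided_prod j xs))) / real j ^ k"
proof (induction k arbitrary: y)
  case 0
  have "{xs::nat list. set xs \<subseteq> {1..j} \<and> length xs = 0} = {[]}" by auto
  then show ?case by (simp add: one_sided_prod_def)
next
  case (Suc k)
  let ?L = "\<lambda>k. {xs. set xs \<subseteq> {1..j} \<and> length xs = k}"
  have inv: "inv (one_sided_prod j (i # xs)) = transpose j i \<circ> inv (one_sided_prod j xs)"
    if "set xs \<subseteq> {1..j}" for i xs
    unfolding one_sided_prod_Cons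
    using one_sided_prod_permutes[OF that, of j] assms
    by (subst o_inv_distrib) (auto intro: permutes_bij)
  have "(\<Sum>xs\<in>?L (Suc k). f (y \<circ> inv (one_sided_prod j xs)))
      = (\<Sum>(xs, i)\<in>?L k \<times> {1..j}. f (y \<circ> inv (one_sided_prod j (i # xs))))"
    unfolding lists_length_Suc_eq
    by (subst sum.reindex) (auto simp: inj_on_def case_prod_unfold)
  also have "\<dots> = (\<Sum>xs\<in>?L k. \<Sum>i\<in>{1..j}. f (y \<circ> transpose j i \<circ> inv (one_sided_prod j xs)))"
    unfolding sum.cartesian_product[symmetric] by (simp add: inv comp_assoc)
  also have "\<dots> = (\<Sum>i\<in>{1..j}. \<Sum>xs\<in>?L k. f (y \<circ> transpose j i \<circ> inv (one_sided_prod j xs)))"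
    by (rule sum.swap)
  finally have sums: "(\<Sum>i\<in>{1..j}. \<Sum>xs\<in>?L k. f (y \<circ> transpose j i \<circ> inv (one_sided_prod j xs)))
      = (\<Sum>xs\<in>?L (Suc k). f (y \<circ> inv (one_sided_prod j xs)))" ..
  have "(star_avg j ^^ Suc k) f y = (\<Sum>i\<in>{1..j}. (star_avg j ^^ k) f (y \<circ> transpose j i)) / real j"
    by (simp add: star_avg_def[of j "(star_avg j ^^ k) f"])
  also have "\<dots> = (\<Sum>i\<in>{1..j}. \<Sum>xs\<in>?L k. f (y \<circ> transpose j i \<circ> inv (one_sided_prod j xs)))
      / real j ^ k / real j"
    unfolding Suc by (simp only: sum_divide_distrib)
  finally show ?case unfolding sums by (simp only: divide_divide_eq_left power_Suc mult.commute)
qed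

lemma finite_sym_perms: "finite (sym_perms n)"
  by (simp add: sym_perms_def finite_permutations)

lemma card_sym_perms: "card (sym_perms n) = fact n"
  by (simp add: sym_perms_def card_permutations)

text \<open>With the condition on \<open>\<tau>\<close> moved into the summand, the sums can be
  interchanged with a sum over intermediate states.\<close>

lemma shuffle_prob_eq:
  "shuffle_prob n k \<tau> = (\<Sum>j\<in>{1..n}. \<Sum>xs | set xs \<subseteq> {1..j} \<and> length xs = k.
     if \<tau> = one_sided_prod j xs then 1 / (real n * real j ^ k) else 0)"
proof -
  let ?S = "Sigma {1..n} (\<lambda>j. {xs. set xs \<subseteq> {1..j} \<and> length xs = k})"
  have fin: "finite {xs. set xs \<subseteq> {1..j::nat} \<and> length xs = k}" for j
    by (rule finite_lists_length_eq) simp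
  have "{(j, xs). j \<in> {1..n} \<and> length xs = k \<and> set xs \<subseteq> {1..j} \<and> \<tau> = one_sided_prod j xs}
      = {p \<in> ?S. \<tau> = one_sided_prod (fst p) (snd p)}" by auto
  then have "shuffle_prob n k \<tau> = (\<Sum>p\<in>{p \<in> ?S. \<tau> = one_sided_prod (fst p) (snd p)}.
      1 / (real n * real (fst p) ^ k))"
    by (simp add: shuffle_prob_def case_prod_unfold)
  also have "\<dots> = (\<Sum>p\<in>?S. if \<tau> = one_sided_prod (fst p) (snd p) then 1 / (real n * real (fst p) ^ k) else 0)"
    using fin by (intro sum.inter_filter) auto
  also have "\<dots> = (\<Sum>(j, xs)\<in>?S. if \<tau> = one_sided_prod j xs then 1 / (real n * real j ^ k) else 0)"
    by (simp add: case_prod_unfold)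
  also have "\<dots> = (\<Sum>j\<in>{1..n}. \<Sum>xs | set xs \<subseteq> {1..j} \<and> length xs = k.
     if \<tau> = one_sided_prod j xs then 1 / (real n * real j ^ k) else 0)"
    using fin by (subst sum.Sigma) auto
  finally show ?thesis .
qed

lemma matrix_power_shuffle_eq:
  assumes "y \<in> sym_perms n"
  shows "matrix_power_on (sym_perms n) (shuffle_matrix n k) t id y
    = (shuffle_step n k ^^ t) (point_mass id) y"
  using assms
proof (induction t arbitrary: y)
  case 0
  then show ?case by (simp add: point_mass_def)
next
  case (Suc t)
  let ?g = "(shuffle_step n k ^^ t) (point_mass id)"
  let ?L = "\<lambda>j. {xs. set xs \<subseteq> {1..j} \<and> length xs = k}"
  \<comment> \<open>For a fixed increment \<open>q\<close>, exactly one predecessor of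
    \<open>y\<close> contributes.\<close>
  have pick: "(\<Sum>z\<in>sym_perms n. ?g z * (if inv z \<circ> y = q then c else 0)) = c * ?g (y \<circ> inv q)"
    if q: "q permutes {1..n}" for q c
  proof -
    have y: "y permutes {1..n}" using Suc.prems by (simp add: sym_perms_def)
    have iff: "inv z \<circ> y = q \<longleftrightarrow> z = y \<circ> inv q" if z: "z permutes {1..n}" for z
    proof
      assume "inv z \<circ> y = q"
      then have "z \<circ> (inv z \<circ> y) \<circ> inv q = z \<circ> q \<circ> inv q" by simp
      then show "z = y \<circ> inv q"
        using permutes_inv_o[OF z] permutes_inv_o[OF q] by (simp add: comp_assoc flip: o_assoc) (simp add: o_assoc)
    next
      assume "z = y \<circ> inv q"
      then have "z \<circ> q = y" using permutes_inv_o[OF q] by (simp add: comp_assoc)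
      then show "inv z \<circ> y = q" using permutes_inv_o[OF z] by (metis comp_assoc id_comp)
    qed
    have "(\<Sum>z\<in>sym_perms n. ?g z * (if inv z \<circ> y = q then c else 0))
        = (\<Sum>z\<in>sym_perms n. if z = y \<circ> inv q then c * ?g z else 0)"
      by (intro sum.cong) (auto simp: sym_perms_def iff)
    also have "\<dots> = c * ?g (y \<circ> inv q)"
      using permutes_compose[OF permutes_inv[OF q] y]
      by (subst sum.delta) (auto simp: finite_sym_perms, simp add: sym_perms_def)
    finally show ?thesis .
  qed
  have "matrix_power_on (sym_perms n) (shuffle_matrix n k) (Suc t) id y
      = (\<Sum>z\<in>sym_perms n. ?g z * shuffle_prob n k (inv z \<circ> y))"
    unfolding matrix_power_on.simps
    by (intro sum.cong refl) (simp only: Suc.IH shuffle_matrix_def[of n k _ y])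
  also have "\<dots> = (\<Sum>z\<in>sym_perms n. \<Sum>j\<in>{1..n}. \<Sum>xs\<in>?L j.
      ?g z * (if inv z \<circ> y = one_sided_prod j xs then 1 / (real n * real j ^ k) else 0))"
    unfolding shuffle_prob_eq sum_distrib_left ..
  also have "\<dots> = (\<Sum>j\<in>{1..n}. \<Sum>xs\<in>?L j. \<Sum>z\<in>sym_perms n.
      ?g z * (if inv z \<circ> y = one_sided_prod j xs then 1 / (real n * real j ^ k) else 0))"
    by (subst sum.swap, intro sum.cong refl, rule sum.swap)
  also have "\<dots> = (\<Sum>j\<in>{1..n}. \<Sum>xs\<in>?L j. 1 / (real n * real j ^ k) * ?g (y \<circ> inv (one_sided_prod j xs)))"
    by (intro sum.cong refl pick one_sided_prod_permutes) auto
  also have "\<dots> = (\<Sum>j\<in>{1..n}. (star_avg j ^^ k) ?g y / real n)"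
    by (intro sum.cong refl, subst star_avg_power_eq) (simp_all add: sum_divide_distrib mult.commute)
  also have "\<dots> = (shuffle_step n k ^^ Suc t) (point_mass id) y"
    by (simp add: shuffle_step_def[of n k ?g] sum_divide_distrib)
  finally show ?case .
qed

section \<open>Uniform distributions on cosets\<close>

lemma permutes_iff_bij: "p permutes S \<longleftrightarrow> bij p \<and> (\<forall>x. x \<notin> S \<longrightarrow> p x = x)"
  by (auto simp: permutes_def bij_iff)

lemma permutes_conj_transpose_iff:
  "transpose a b \<circ> p \<circ> transpose a b permutes transpose a b ` T \<longleftrightarrow> p permutes T"
proof -
  have *: "transpose a b \<circ> p \<circ> transpose a b permutes transpose a b ` T" if p: "p permutes T" for p T
    unfolding permutes_iff_bij
  proof (intro conjI allI impI)
    show "bij (transpose a b \<circ> p \<circ> transpose a b)"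
      using permutes_bij[OF p] by (intro bij_comp bij_transpose)
    fix x assume "x \<notin> transpose a b ` T"
    then have "transpose a b x \<notin> T" by (metis image_eqI transpose_involutory)
    then show "(transpose a b \<circ> p \<circ> transpose a b) x = x"
      using permutes_not_in[OF p] by simp
  qed
  have "transpose a b \<circ> (transpose a b \<circ> p \<circ> transpose a b) \<circ> transpose a b = p"
    by (simp add: fun_eq_iff)
  moreover have "transpose a b ` transpose a b ` T = T" by (simp add: image_image)
  ultimately show ?thesis
    using *[of "transpose a b \<circ> p \<circ> transpose a b" "transpose a b ` T"] *[of p T] by metis
qed

text \<open>For finite \<open>T\<close> and bijective \<open>\<sigma>\<close>, the density of the
  uniform distribution on the left coset \<open>\<sigma> Sym(T)\<close>.\<close>

definition coset_unif :: "'a set \<Rightarrow> ('a \<Rightarrow> 'a) \<Rightarrow> ('a \<Rightarrow> 'a) \<Rightarrow> real" where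
  "coset_unif T \<sigma> y = (if inv \<sigma> \<circ> y permutes T then 1 / fact (card T) else 0)"

lemma coset_unif_comp_transpose_mem:
  assumes "a \<in> T" "b \<in> T"
  shows "coset_unif T \<sigma> (y \<circ> transpose a b) = coset_unif T \<sigma> y"
proof -
  have "inv \<sigma> \<circ> y permutes T" if "inv \<sigma> \<circ> (y \<circ> transpose a b) permutes T"
  proof -
    have "inv \<sigma> \<circ> (y \<circ> transpose a b) \<circ> transpose a b permutes T"
      using that permutes_swap_id[OF assms] by (rule permutes_compose[rotated])
    then show ?thesis by (simp add: comp_assoc)
  qed
  moreover have "inv \<sigma> \<circ> (y \<circ> transpose a b) permutes T" if "inv \<sigma> \<circ> y permutes T"
    using permutes_compose[OF permutes_swap_id[OF assms] that] by (simp add: comp_assoc)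
  ultimately show ?thesis unfolding coset_unif_def by auto
qed

text \<open>For a transposition \<open>s\<close>,
  \<open>\<sigma> Sym(T) s = (\<sigma> s) (s Sym(T) s)\<close>, and the last factor is the symmetric
  group of \<open>s(T)\<close>.\<close>

lemma coset_unif_comp_transpose:
  assumes "bij \<sigma>"
  shows "coset_unif T \<sigma> (y \<circ> transpose a b) = coset_unif (transpose a b ` T) (\<sigma> \<circ> transpose a b) y"
proof -
  have "inv (\<sigma> \<circ> transpose a b) \<circ> y
      = transpose a b \<circ> (inv \<sigma> \<circ> (y \<circ> transpose a b)) \<circ> transpose a b"
    by (subst o_inv_distrib) (use assms in \<open>simp_all add: comp_assoc\<close>)
  moreover have "card (transpose a b ` T) = card T"
    by (intro card_image inj_on_subset[OF bij_is_inj[OF bij_transpose]]) simp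
  ultimately show ?thesis
    unfolding coset_unif_def by (simp only: permutes_conj_transpose_iff)
qed

text \<open>One step of the Fisher--Yates algorithm.\<close>
lemma sum_coset_unif_comp_transpose_insert:
  assumes "finite T" "n \<notin> T"
  shows "(\<Sum>i\<in>insert n T. coset_unif T \<sigma> (y \<circ> transpose n i))
    = real (Suc (card T)) * coset_unif (insert n T) \<sigma> y"
proof -
  define p where "p = inv \<sigma> \<circ> y"
  have comp: "inv \<sigma> \<circ> (y \<circ> transpose n i) = p \<circ> transpose n i" for i
    by (simp add: p_def comp_assoc)
  have unfix: "p permutes insert n T" if "i \<in> insert n T" "p \<circ> transpose n i permutes insert n T" for i
  proof -
    have "p \<circ> transpose n i \<circ> transpose n i permutes insert n T"
      using that by (intro permutes_compose[OF permutes_swap_id that(2)]) auto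
    then show ?thesis by (simp add: comp_assoc)
  qed
  show ?thesis
  proof (cases "p permutes insert n T")
    case True
    \<comment> \<open>An element of the larger group lies in \<open>Sym(T)\<close> iff it fixes
      \<open>n\<close>, so exactly one \<open>i\<close> contributes.\<close>
    have iff: "p \<circ> transpose n i permutes T \<longleftrightarrow> i = inv p n" if i: "i \<in> insert n T" for i
    proof -
      have q: "p \<circ> transpose n i permutes insert n T"
        using i True by (intro permutes_compose[OF permutes_swap_id]) auto
      have "p \<circ> transpose n i permutes T" if "(p \<circ> transpose n i) n = n"
        by (rule permutes_superset[OF q]) (metis that Diff_iff insertE)
      then have "p \<circ> transpose n i permutes T \<longleftrightarrow> (p \<circ> transpose n i) n = n"
        using permutes_not_in[of "p \<circ> transpose n i" T n] assms(2) by blast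
      also have "\<dots> \<longleftrightarrow> i = inv p n" using permutes_inv_eq[OF True, of n i] by auto
      finally show ?thesis .
    qed
    have "inv p n \<in> insert n T" using permutes_in_image[OF permutes_inv[OF True], of n] by simp
    moreover have "(\<Sum>i\<in>insert n T. coset_unif T \<sigma> (y \<circ> transpose n i))
        = (\<Sum>i\<in>insert n T. if i = inv p n then 1 / fact (card T) else 0)"
      by (intro sum.cong refl) (simp only: coset_unif_def comp iff)
    ultimately have "(\<Sum>i\<in>insert n T. coset_unif T \<sigma> (y \<circ> transpose n i)) = 1 / fact (card T)"
      using assms by (simp add: sum.delta)
    moreover have "coset_unif (insert n T) \<sigma> y = 1 / fact (Suc (card T))"
      using True assms by (simp add: coset_unif_def p_def)
    ultimately show ?thesis by (simp del: of_nat_Suc)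
  next
    case False
    have "coset_unif T \<sigma> (y \<circ> transpose n i) = 0" if "i \<in> insert n T" for i
      using unfix[OF that] False permutes_subset[of "p \<circ> transpose n i" T "insert n T"]
      unfolding coset_unif_def comp by auto
    moreover have "coset_unif (insert n T) \<sigma> y = 0"
      using False by (simp add: coset_unif_def p_def)
    ultimately show ?thesis by simp
  qed
qed

section \<open>The strong stationary time of the star transposition walk\<close>

text \<open>The probability that the strong stationary time has not occurred within \<open>r\<close> steps, started
  from the uniform distribution on a coset of the symmetric group of a set of size \<open>m\<close>, which
  contains the centre of the star iff \<open>b\<close>.\<close>
primrec unmixed :: "nat \<Rightarrow> nat \<Rightarrow> bool \<Rightarrow> nat \<Rightarrow> real" where
  "unmixed 0 n b m = (if b \<and> m = n then 0 else 1)"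
| "unmixed (Suc r) n b m =
    (if b then (real m * unmixed r n True m + (real n - real m) * unmixed r n False m) / real n
     else (real (Suc m) * unmixed r n True (Suc m) + (real n - real (Suc m)) * unmixed r n False m) / real n)"

lemma sum_if_mem_const:
  fixes a b :: real
  assumes "D \<subseteq> {1..n}"
  shows "(\<Sum>i\<in>{1..n}. if i \<in> D then a else b) = real (card D) * a + (real n - real (card D)) * b"
proof -
  have fin: "finite D" using assms finite_subset by blast
  have "card ({1..n} - D) = n - card D" using assms fin by (simp add: card_Diff_subset)
  moreover have "card D \<le> n" using card_mono[OF _ assms] by simp
  moreover have "{1..n} \<inter> D = D" "{1..n} \<inter> - D = {1..n} - D" using assms by auto
  ultimately show ?thesis by (simp add: sum.If_cases of_nat_diff)
qed

text \<open>Conditioning on the first transposition leaves a mixture of coset distributions, whose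
  sets follow the recursion of \<open>unmixed\<close>.\<close>

lemma star_avg_power_coset_unif_ge:
  assumes "n \<ge> 1" "T \<subseteq> {1..n}" "\<sigma> permutes {1..n}" "y permutes {1..n}"
  shows "(1 - unmixed r n (n \<in> T) (card T)) / fact n \<le> (star_avg n ^^ r) (coset_unif T \<sigma>) y"
  using assms(2,3)
proof (induction r arbitrary: T \<sigma>)
  case 0
  \<comment> \<open>The bound is positive only if \<open>T\<close> is all of \<open>{1..n}\<close>,
    and then the coset is the whole group.\<close>
  have "card T = n \<Longrightarrow> T = {1..n}" using 0 by (intro card_subset_eq) auto
  moreover have "inv \<sigma> \<circ> y permutes {1..n}"
    using assms(4) permutes_inv[OF 0(2)] by (rule permutes_compose)
  ultimately show ?case by (auto simp: coset_unif_def)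
next
  case (Suc r)
  \<comment> \<open>The choices \<open>i \<in> D\<close> jointly yield the uniform distribution on
    the coset for \<open>D\<close>: nothing changes if \<open>n \<in> T\<close>, otherwise this is a
    Fisher-Yates step. Any other \<open>i\<close> gives a set without \<open>n\<close>.\<close>
  define D where "D = (if n \<in> T then T else insert n T)"
  define g where "g i = (if i \<in> D then coset_unif D \<sigma>
    else coset_unif (transpose n i ` T) (\<sigma> \<circ> transpose n i))" for i
  have fin: "finite T" using Suc.prems(1) finite_subset by blast
  have D: "D \<subseteq> {1..n}" "n \<in> D" using Suc.prems(1) assms(1) by (auto simp: D_def)
  have cardD: "card D = (if n \<in> T then card T else Suc (card T))" using fin by (simp add: D_def)
  have "(\<Sum>i\<in>{1..n}. coset_unif T \<sigma> (z \<circ> transpose n i)) = (\<Sum>i\<in>{1..n}. g i z)" for z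
  proof -
    have "(\<Sum>i\<in>D. coset_unif T \<sigma> (z \<circ> transpose n i)) = (\<Sum>i\<in>D. coset_unif D \<sigma> z)"
      using sum_coset_unif_comp_transpose_insert[OF fin, of n \<sigma> z] fin coset_unif_comp_transpose_mem[of n T]
      by (auto simp: D_def intro!: sum.cong)
    then have "(\<Sum>i\<in>D. coset_unif T \<sigma> (z \<circ> transpose n i)) = (\<Sum>i\<in>D. g i z)"
      by (simp add: g_def)
    moreover have "(\<Sum>i\<in>{1..n} - D. coset_unif T \<sigma> (z \<circ> transpose n i)) = (\<Sum>i\<in>{1..n} - D. g i z)"
      using coset_unif_comp_transpose[OF permutes_bij[OF Suc.prems(2)]]
      by (intro sum.cong) (auto simp: g_def)
    ultimately show ?thesis
      using sum.subset_diff[OF D(1)] finite_atLeastAtMost by metis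
  qed
  then have "star_avg n (coset_unif T \<sigma>) = (\<lambda>z. (\<Sum>i\<in>{1..n}. 1 * g i z) / real n)"
    by (simp add: star_avg_def fun_eq_iff)
  then have eq: "(star_avg n ^^ Suc r) (coset_unif T \<sigma>) y = (\<Sum>i\<in>{1..n}. (star_avg n ^^ r) (g i) y) / real n"
    unfolding funpow_Suc_right comp_def by (simp only: star_avg_power_linear) simp
  let ?a = "(1 - unmixed r n True (card D)) / fact n"
  let ?b = "(1 - unmixed r n False (card T)) / fact n"
  have "real n * ((1 - unmixed (Suc r) n (n \<in> T) (card T)) / fact n)
      = real (card D) * ?a + (real n - real (card D)) * ?b"
    using assms(1) by (cases "n \<in> T") (simp_all add: cardD field_simps)
  also have "\<dots> = (\<Sum>i\<in>{1..n}. if i \<in> D then ?a else ?b)"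
    by (rule sum_if_mem_const[OF D(1), symmetric])
  also have "\<dots> \<le> (\<Sum>i\<in>{1..n}. (star_avg n ^^ r) (g i) y)"
  proof (rule sum_mono)
    fix i assume i: "i \<in> {1..n}"
    show "(if i \<in> D then ?a else ?b) \<le> (star_avg n ^^ r) (g i) y"
    proof (cases "i \<in> D")
      case True
      then show ?thesis using Suc.IH[OF D(1) Suc.prems(2)] D(2) by (simp add: g_def)
    next
      case False
      have s: "transpose n i permutes {1..n}" using i assms(1) by (intro permutes_swap_id) auto
      have "transpose n i ` T \<subseteq> {1..n}" using permutes_image[OF s] Suc.prems(1) by blast
      moreover have "n \<notin> transpose n i ` T"
        using False by (auto simp: D_def transpose_def split: if_splits)
      moreover have "card (transpose n i ` T) = card T"
        by (intro card_image inj_on_subset[OF permutes_inj[OF s]]) simp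
      ultimately show ?thesis
        using Suc.IH[OF _ permutes_compose[OF s Suc.prems(2)], of "transpose n i ` T"] False
        by (simp add: g_def comp_def)
    qed
  qed
  finally show ?case unfolding eq using assms(1) by (simp add: field_simps)
qed

text \<open>A set avoiding the centre is proper, so the state \<open>False\<close> with
  \<open>m = n\<close> is excluded; the recursion refers to it from admissible states only with
  weight zero.\<close>

lemma unmixed_bounds:
  assumes "m \<le> n" "\<not> b \<Longrightarrow> m < n" 
  shows "0 \<le> unmixed r n b m \<and> unmixed r n b m \<le> 1"
  using assms
proof (induction r arbitrary: b m)
  case (Suc r)
  have conv: "0 \<le> (real p * x + (real n - real p) * z) / real n \<and> (real p * x + (real n - real p) * z) / real n \<le> 1"
    if "0 \<le> x" "x \<le> 1" "p = n \<or> 0 \<le> z \<and> z \<le> 1" "p \<le> n" for p x z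
  proof -
    have "(real n - real p) * z \<le> (real n - real p) * 1" "0 \<le> (real n - real p) * z"
      using that mult_left_mono[of z 1 "real n - real p"] by auto
    moreover have "real p * x \<le> real p * 1" "0 \<le> real p * x"
      using that mult_left_mono[of x 1 "real p"] by auto
    ultimately show ?thesis by (cases "n = 0") (simp_all add: pos_divide_le_eq)
  qed
  show ?case
  proof (cases b)
    case True
    then show ?thesis using Suc.IH[of m True] Suc.IH[of m False] Suc.prems
      by (simp, intro conv) auto
  next
    case False
    then show ?thesis using Suc.IH[of "Suc m" True] Suc.IH[of m False] Suc.prems
      by (simp only: unmixed.simps if_False, intro conv) auto
  qed
qed simp

text \<open>The recursion is monotone because its weights are nonnegative, so the comparison of zero
  steps with one step propagates.\<close>

lemma unmixed_Suc_le:
  assumes "m \<le> n" "\<not> b \<Longrightarrow> m < n" 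
  shows "unmixed (Suc r) n b m \<le> unmixed r n b m"
  using assms
proof (induction r arbitrary: b m)
  case 0
  show ?case
  proof (cases "b \<and> m = n")
    case True
    then show ?thesis by simp
  next
    case False
    then have "unmixed 0 n b m = 1" by auto
    then show ?thesis using unmixed_bounds[of m n b "Suc 0"] 0 by (simp del: unmixed.simps)
  qed
next
  case (Suc r)
  have conv: "(real p * x + (real n - real p) * z) / real n \<le> (real p * x' + (real n - real p) * z') / real n"
    if "x \<le> x'" "p = n \<or> z \<le> z'" "p \<le> n" for p x x' z z'
  proof -
    have "(real n - real p) * z \<le> (real n - real p) * z'"
      using that by (cases "p = n") (auto intro!: mult_left_mono)
    then show ?thesis using that by (intro divide_right_mono add_mono[OF mult_left_mono]) auto
  qed
  \<comment> \<open>Generic step counts \<open>q\<close> and \<open>q'\<close> keep the recursion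
    from being unfolded twice.\<close>
  have mono: "unmixed (Suc q) n b m \<le> unmixed (Suc q') n b m"
    if "\<And>b m. m \<le> n \<Longrightarrow> (\<not> b \<Longrightarrow> m < n) \<Longrightarrow> unmixed q n b m \<le> unmixed q' n b m" for q q'
  proof (cases b)
    case True
    have "m = n \<or> unmixed q n False m \<le> unmixed q' n False m"
      using that[of m False] Suc.prems(1) by (cases "m = n") auto
    then show ?thesis unfolding unmixed.simps(2) if_P[OF True]
      using that[of m True] Suc.prems by (intro conv) auto
  next
    case False
    then show ?thesis unfolding unmixed.simps(2) if_not_P[OF False]
      using that[of m False] that[of "Suc m" True] Suc.prems by (intro conv) auto
  qed
  show ?case by (rule mono) (rule Suc.IH)
qed

text \<open>The expectation of the strong stationary time: in the state with a set of size \<open>m\<close> that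
  contains the centre, a step leaves it with probability \<open>(n - m) / n\<close>, and then the set
  absorbs the centre with probability \<open>(m + 1) / n\<close> in each step.\<close>
definition mixing_expectation :: "nat \<Rightarrow> nat \<Rightarrow> real" where
  "mixing_expectation n m = (\<Sum>l\<in>{m..<n}. real n / (real n - real l) + real n / real (Suc l))"

text \<open>Sums of tail probabilities are truncated expectations, and the right-hand sides solve
  the first-step equations of the full ones. Without the centre, the waiting time
  \<open>n / (n - m)\<close> for losing it is saved.\<close>

lemma sum_unmixed_le:
  assumes "n \<ge> 1"
  shows "(m \<le> n \<longrightarrow> (\<Sum>r<R. unmixed r n True m) \<le> mixing_expectation n m) \<and>
    (m < n \<longrightarrow> (\<Sum>r<R. unmixed r n False m) \<le> mixing_expectation n m - real n / (real n - real m))"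
proof (induction R arbitrary: m)
  case 0
  have "0 \<le> mixing_expectation n m"
    unfolding mixing_expectation_def by (intro sum_nonneg) auto
  moreover have "0 \<le> mixing_expectation n m - real n / (real n - real m)" if "m < n"
  proof -
    have "0 \<le> mixing_expectation n (Suc m)"
      unfolding mixing_expectation_def by (intro sum_nonneg) auto
    then show ?thesis using that by (simp add: mixing_expectation_def sum.atLeast_Suc_lessThan)
  qed
  ultimately show ?case by simp
next
  case (Suc R)
  let ?A = "\<lambda>m. \<Sum>r<R. unmixed r n True m" and ?B = "\<lambda>m. \<Sum>r<R. unmixed r n False m"
  have pull: "(\<Sum>r<R. (c * x r + d * z r) / real n) = (c * (\<Sum>r<R. x r) + d * (\<Sum>r<R. z r)) / real n"
    for c d :: real and x z :: "nat \<Rightarrow> real"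
    by (simp add: sum.distrib sum_distrib_left flip: sum_divide_distrib)
  have A: "(\<Sum>r<Suc R. unmixed r n True m)
      = unmixed 0 n True m + (real m * ?A m + (real n - real m) * ?B m) / real n"
    unfolding sum.lessThan_Suc_shift unmixed.simps(2) if_True pull ..
  have B: "(\<Sum>r<Suc R. unmixed r n False m)
      = 1 + (real (Suc m) * ?A (Suc m) + (real n - real (Suc m)) * ?B m) / real n"
    unfolding sum.lessThan_Suc_shift unmixed.simps(2) if_False pull by simp
  let ?e = "mixing_expectation n m" and ?h = "real n / (real n - real m)"
  have n0: "real n > 0" using assms by simp
  show ?case
  proof (intro conjI impI)
    assume "m \<le> n"
    show "(\<Sum>r<Suc R. unmixed r n True m) \<le> ?e"
    proof (cases "m = n")
      case True
      then show ?thesis using A Suc[of m] n0 by simp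
    next
      case False
      then have mn: "m < n" using \<open>m \<le> n\<close> by simp
      have "(real n - real m) * ?B m \<le> (real n - real m) * (?e - ?h)"
        using Suc[of m] mn by (intro mult_left_mono) auto
      moreover have "real m * ?A m \<le> real m * ?e" using Suc[of m] mn by (intro mult_left_mono) auto
      \<comment> \<open>The factor \<open>n - m\<close> cancels in \<open>?h\<close>, which leaves
        exactly the \<open>n\<close> that pays for the step taken.\<close>
      moreover have "real m * ?e + (real n - real m) * (?e - ?h) = real n * (?e - 1)"
        using mn by (simp add: field_simps)
      ultimately have "real m * ?A m + (real n - real m) * ?B m \<le> real n * (?e - 1)" by linarith
      then have "(real m * ?A m + (real n - real m) * ?B m) / real n \<le> ?e - 1"
        using n0 by (simp add: field_simps)
      then show ?thesis unfolding A using False by simp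
    qed
  next
    assume mn: "m < n"
    let ?e' = "mixing_expectation n (Suc m)"
    have e: "?e - ?h = real n / real (Suc m) + ?e'"
      using mn by (simp add: mixing_expectation_def sum.atLeast_Suc_lessThan)
    have "(real n - real (Suc m)) * ?B m \<le> (real n - real (Suc m)) * (real n / real (Suc m) + ?e')"
      using Suc[of m] mn e by (intro mult_left_mono) auto
    moreover have "real (Suc m) * ?A (Suc m) \<le> real (Suc m) * ?e'"
      using Suc[of "Suc m"] mn by (intro mult_left_mono) auto
    moreover have "real (Suc m) * ?e' + (real n - real (Suc m)) * (real n / real (Suc m) + ?e')
        = real n * (real n / real (Suc m) + ?e' - 1)"
      by (simp add: field_simps del: of_nat_Suc)
    ultimately have "real (Suc m) * ?A (Suc m) + (real n - real (Suc m)) * ?B m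
        \<le> real n * (real n / real (Suc m) + ?e' - 1)" by linarith
    then have "(real (Suc m) * ?A (Suc m) + (real n - real (Suc m)) * ?B m) / real n
        \<le> real n / real (Suc m) + ?e' - 1"
      using n0 by (simp add: field_simps del: of_nat_Suc)
    then show "(\<Sum>r<Suc R. unmixed r n False m) \<le> ?e - ?h" unfolding B e by simp
  qed
qed

lemma sum_inverse_le_ln:
  assumes "n \<ge> 1"
  shows "(\<Sum>l\<in>{1..n}. 1 / real l) \<le> 1 + ln (real n)"
  using assms
proof (induction n rule: nat_induct_at_least)
  case (Suc n)
  have "ln (real n / real (Suc n)) \<le> real n / real (Suc n) - 1"
    using Suc by (intro ln_le_minus_one) auto
  moreover have "ln (real n / real (Suc n)) = ln (real n) - ln (real (Suc n))"
    using Suc.hyps by (simp add: ln_div)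
  moreover have "real n / real (Suc n) - 1 = - (1 / real (Suc n))"
    by (simp add: field_simps)
  moreover have "(\<Sum>l\<in>{1..Suc n}. 1 / real l) = (\<Sum>l\<in>{1..n}. 1 / real l) + 1 / real (Suc n)"
    by simp
  ultimately show ?case using Suc.IH by linarith
qed simp

text \<open>Reversing one sum and shifting the other turns both into parts of the harmonic
  sum.\<close>

lemma mixing_expectation_le:
  assumes "n \<ge> 1"
  shows "mixing_expectation n 1 \<le> 2 * real n * (1 + ln (real n))"
proof -
  have 1: "(\<Sum>l\<in>{1..<n}. real n / (real n - real l)) = real n * (\<Sum>l\<in>{1..<n}. 1 / real l)"
    unfolding sum_distrib_left
    by (rule sum.reindex_bij_witness[where i = "\<lambda>l. n - l" and j = "\<lambda>l. n - l"]) (auto simp: of_nat_diff)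
  have 2: "(\<Sum>l\<in>{1..<n}. real n / real (Suc l)) = real n * (\<Sum>l\<in>{2..n}. 1 / real l)"
    unfolding sum_distrib_left
    by (rule sum.reindex_bij_witness[where i = "\<lambda>l. l - 1" and j = Suc]) auto
  have "(\<Sum>l\<in>{1..<n}. 1 / real l) \<le> (\<Sum>l\<in>{1..n}. 1 / real l)"
    "(\<Sum>l\<in>{2..n}. 1 / real l) \<le> (\<Sum>l\<in>{1..n}. 1 / real l)"
    by (intro sum_mono2; auto)+
  then have "(\<Sum>l\<in>{1..<n}. 1 / real l) + (\<Sum>l\<in>{2..n}. 1 / real l) \<le> 2 * (\<Sum>l\<in>{1..n}. 1 / real l)"
    by simp
  also have "\<dots> \<le> 2 * (1 + ln (real n))"
    using sum_inverse_le_ln[OF assms] by (intro mult_left_mono) auto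
  finally have "(\<Sum>l\<in>{1..<n}. 1 / real l) + (\<Sum>l\<in>{2..n}. 1 / real l) \<le> 2 * (1 + ln (real n))" .
  then have "real n * ((\<Sum>l\<in>{1..<n}. 1 / real l) + (\<Sum>l\<in>{2..n}. 1 / real l)) \<le> real n * (2 * (1 + ln (real n)))"
    by (intro mult_left_mono) auto
  also have "real n * ((\<Sum>l\<in>{1..<n}. 1 / real l) + (\<Sum>l\<in>{2..n}. 1 / real l)) = mixing_expectation n 1"
    unfolding mixing_expectation_def sum.distrib 1 2 by (rule distrib_left)
  finally show ?thesis by (simp add: algebra_simps)
qed

text \<open>Markov's inequality: tails decrease, so \<open>R\<close> times the last is at most the
  sum of the first \<open>R\<close> tails.\<close>

lemma unmixed_markov:
  assumes "n \<ge> 1"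
  shows "real R * unmixed R n True 1 \<le> 2 * real n * (1 + ln (real n))"
proof -
  have "decseq (\<lambda>r. unmixed r n True 1)"
    using assms by (intro decseq_SucI unmixed_Suc_le) auto
  then have "(\<Sum>r<R. unmixed R n True 1) \<le> (\<Sum>r<R. unmixed r n True 1)"
    by (intro sum_mono) (auto simp: decseq_def)
  also have "\<dots> \<le> mixing_expectation n 1" using sum_unmixed_le[OF assms, of 1 R] assms by simp
  also have "\<dots> \<le> 2 * real n * (1 + ln (real n))" by (rule mixing_expectation_le[OF assms])
  finally show ?thesis by simp
qed

section \<open>Minorisation of the shuffle\<close>

text \<open>The point mass is the uniform distribution on the trivial group \<open>Sym({n})\<close>,
  so the walk starts from size \<open>1\<close> with the centre included.\<close>

lemma star_avg_power_point_mass_ge: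
  assumes "n \<ge> 1" "y permutes {1..n}"
  shows "(1 - unmixed r n True 1) / fact n \<le> (star_avg n ^^ r) (point_mass id) y"
proof -
  have "point_mass id = coset_unif {n} id"
    by (auto simp: coset_unif_def point_mass_def fun_eq_iff)
  then show ?thesis
    using star_avg_power_coset_unif_ge[OF assms(1) _ permutes_id assms(2), of "{n}" r] assms(1) by simp
qed

text \<open>The number \<open>l\<close> counts the steps with top position \<open>n\<close>, which are moved to the front
  by commutativity. Each of them occurs with probability \<open>1 / n\<close>, and the denominator on the
  left-hand side makes the bound a supersolution of the resulting recursion.\<close>
lemma shuffle_step_power_ge:
  assumes n: "n \<ge> 1" and C: "C \<ge> 0"
    and decay: "\<And>l. unmixed (k * l) n True 1 \<le> C / (real l + 1)"
    and "y permutes {1..n}"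
  shows "(1 - C / (real l + 1 + real t / (2 * real n))) / fact n
    \<le> (shuffle_step n k ^^ t) ((star_avg n ^^ (k * l)) (point_mass id)) y"
  using assms(4)
proof (induction t arbitrary: l y)
  case 0
  have "(1 - C / (real l + 1)) / fact n \<le> (1 - unmixed (k * l) n True 1) / fact n"
    using decay[of l] by (intro divide_right_mono) auto
  also have "\<dots> \<le> (star_avg n ^^ (k * l)) (point_mass id) y"
    by (rule star_avg_power_point_mass_ge[OF n 0])
  finally show ?case unfolding funpow_0 by simp
next
  case (Suc t)
  define x where "x = real l + 1 + real t / (2 * real n)"
  define G where "G = (shuffle_step n k ^^ t) ((star_avg n ^^ (k * l)) (point_mass id))"
  let ?a = "(1 - C / x) / fact n" and ?b = "(1 - C / (x + 1)) / fact n"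
  have x: "x \<ge> 1" by (simp add: x_def)
  have low: "?a \<le> (star_avg j ^^ k) G y" if "j \<in> {1..n}" for j
    using star_avg_power_ge[OF that _ Suc.prems] Suc.IH unfolding G_def x_def by blast
  \<comment> \<open>A step with top position \<open>n\<close> raises \<open>l\<close> by one, hence
    \<open>x\<close> by one.\<close>
  have "(star_avg n ^^ k) G = (shuffle_step n k ^^ t) ((star_avg n ^^ (k * Suc l)) (point_mass id))"
    unfolding G_def star_avg_power_shuffle_step_power mult_Suc_right funpow_add comp_def ..
  moreover have "real (Suc l) + 1 + real t / (2 * real n) = x + 1" by (simp add: x_def)
  ultimately have top: "?b \<le> (star_avg n ^^ k) G y"
    using Suc.IH[OF Suc.prems, of "Suc l"] by (simp only:)
  have "{1..n} = insert n {1..<n}" using n by auto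
  then have "(\<Sum>j\<in>{1..n}. (star_avg j ^^ k) G y)
      = (star_avg n ^^ k) G y + (\<Sum>j\<in>{1..<n}. (star_avg j ^^ k) G y)" by simp
  moreover have "(\<Sum>j\<in>{1..<n}. ?a) \<le> (\<Sum>j\<in>{1..<n}. (star_avg j ^^ k) G y)"
    using low by (intro sum_mono) auto
  ultimately have "(real n - 1) * ?a + ?b \<le> (\<Sum>j\<in>{1..n}. (star_avg j ^^ k) G y)"
    using top n by (simp add: of_nat_diff)
  \<comment> \<open>The supersolution inequality: with probability \<open>1 / n\<close> the gain is
    \<open>1 / x - 1 / (x + 1) = 1 / (x (x + 1))\<close>, and this must pay for raising
    \<open>x\<close> by \<open>1 / (2 n)\<close>. The slack factor \<open>2\<close> suffices because
    \<open>x \<ge> 1\<close> gives \<open>x + 1 \<le> 2 x\<close>.\<close>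
  moreover have "real n * ((1 - C / (x + 1 / (2 * real n))) / fact n) \<le> (real n - 1) * ?a + ?b"
  proof -
    have "1 / x - 1 / (x + 1 / (2 * real n)) = 1 / (2 * real n) / (x * (x + 1 / (2 * real n)))"
      using x n by (subst diff_frac_eq) (auto simp: add_pos_pos less_imp_neq[symmetric])
    then have "real n * (1 / x - 1 / (x + 1 / (2 * real n))) = 1 / (2 * (x * (x + 1 / (2 * real n))))"
      using n by simp
    also have "\<dots> \<le> 1 / (x * (x + 1))"
    proof (rule divide_left_mono)
      have "x * (x + 1) \<le> x * (2 * (x + 1 / (2 * real n)))"
        using x n by (intro mult_left_mono) (auto simp: add_increasing2)
      then show "x * (x + 1) \<le> 2 * (x * (x + 1 / (2 * real n)))" by (simp only: mult_ac)
      show "0 < 2 * (x * (x + 1 / (2 * real n))) * (x * (x + 1))"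
        using x by (intro mult_pos_pos add_pos_nonneg) auto
    qed simp
    also have "\<dots> = 1 / x - 1 / (x + 1)" using x by (simp add: field_simps)
    finally have "C * (real n * (1 / x - 1 / (x + 1 / (2 * real n)))) \<le> C * (1 / x - 1 / (x + 1))"
      using C by (rule mult_left_mono)
    then have "real n * (1 - C / (x + 1 / (2 * real n))) \<le> (real n - 1) * (1 - C / x) + (1 - C / (x + 1))"
      by (simp add: algebra_simps)
    then have "real n * (1 - C / (x + 1 / (2 * real n))) / fact n
        \<le> ((real n - 1) * (1 - C / x) + (1 - C / (x + 1))) / fact n"
      by (intro divide_right_mono) auto
    then show ?thesis by (simp add: add_divide_distrib)
  qed
  ultimately have "real n * ((1 - C / (x + 1 / (2 * real n))) / fact n)
      \<le> (\<Sum>j\<in>{1..n}. (star_avg j ^^ k) G y)" by linarith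
  then have "(1 - C / (x + 1 / (2 * real n))) / fact n \<le> shuffle_step n k G y"
    unfolding shuffle_step_def using n by (simp add: field_simps)
  moreover have "x + 1 / (2 * real n) = real l + 1 + real (Suc t) / (2 * real n)"
    by (simp add: x_def add_divide_distrib)
  ultimately show ?case by (simp only: funpow.simps comp_apply G_def)
qed

section \<open>Bounds on the total variation distance\<close>

text \<open>Separation dominates total variation: the excess of \<open>p\<close> over
  \<open>(1 - d) / card A\<close> is nonnegative with total mass \<open>d\<close>, and the uniform
  density has the same excess mass.\<close>

lemma half_l1_dist_le:
  fixes p :: "'a \<Rightarrow> real"
  assumes "finite A" "A \<noteq> {}" "(\<Sum>y\<in>A. p y) = 1" "d \<ge> 0"
    and "\<And>y. y \<in> A \<Longrightarrow> (1 - d) / real (card A) \<le> p y"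
  shows "1/2 * (\<Sum>y\<in>A. \<bar>p y - 1 / real (card A)\<bar>) \<le> d"
proof -
  have N: "real (card A) > 0" using assms(1,2) by (simp add: card_gt_0_iff)
  have "(\<Sum>y\<in>A. \<bar>p y - 1 / real (card A)\<bar>) \<le> (\<Sum>y\<in>A. p y - (1 - d) / real (card A) + d / real (card A))"
  proof (rule sum_mono)
    fix y assume "y \<in> A"
    moreover have "1 / real (card A) = (1 - d) / real (card A) + d / real (card A)"
      by (simp add: diff_divide_distrib)
    moreover have "0 \<le> d / real (card A)" using assms(4) N by simp
    ultimately show "\<bar>p y - 1 / real (card A)\<bar> \<le> p y - (1 - d) / real (card A) + d / real (card A)"
      using assms(5)[of y] by linarith
  qed
  also have "\<dots> = 2 * d" using N assms(3) by (simp add: sum.distrib sum_subtractf)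
  finally show ?thesis by simp
qed

text \<open>As the total masses agree, the surplus on \<open>B\<close> equals the deficit off
  \<open>B\<close>, and the full sum counts both.\<close>

lemma half_l1_dist_ge:
  fixes p q :: "'a \<Rightarrow> real"
  assumes "finite A" "B \<subseteq> A" "(\<Sum>y\<in>A. p y) = (\<Sum>y\<in>A. q y)"
  shows "(\<Sum>y\<in>B. p y) - (\<Sum>y\<in>B. q y) \<le> 1/2 * (\<Sum>y\<in>A. \<bar>p y - q y\<bar>)"
proof -
  have split: "(\<Sum>y\<in>A. h y) = (\<Sum>y\<in>A - B. h y) + (\<Sum>y\<in>B. h y)" for h :: "'a \<Rightarrow> real"
    using assms(1,2) by (rule sum.subset_diff[rotated])
  have "(\<Sum>y\<in>B. p y - q y) \<le> (\<Sum>y\<in>B. \<bar>p y - q y\<bar>)" by (intro sum_mono) auto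
  moreover have "(\<Sum>y\<in>A - B. q y - p y) \<le> (\<Sum>y\<in>A - B. \<bar>p y - q y\<bar>)" by (intro sum_mono) auto
  ultimately show ?thesis
    using assms(3) split[of p] split[of q] split[of "\<lambda>y. \<bar>p y - q y\<bar>"] by (simp add: sum_subtractf)
qed

lemma tv_dist_eq:
  "tv_dist n k t = 1/2 * (\<Sum>y\<in>sym_perms n.
    \<bar>(shuffle_step n k ^^ t) (point_mass id) y - 1 / real (card (sym_perms n))\<bar>)"
  by (simp add: tv_dist_def matrix_power_shuffle_eq)

lemma id_in_sym_perms: "id \<in> sym_perms n"
  unfolding sym_perms_def using permutes_id by simp

lemma sum_point_mass: "finite A \<Longrightarrow> x \<in> A \<Longrightarrow> (\<Sum>y\<in>A. point_mass x y) = 1"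
  by (simp add: point_mass_def)

lemma tv_dist_le:
  assumes "n \<ge> 1" "C \<ge> 0" "\<And>l. unmixed (k * l) n True 1 \<le> C / (real l + 1)"
  shows "tv_dist n k t \<le> C / (1 + real t / (2 * real n))"
  unfolding tv_dist_eq
proof (rule half_l1_dist_le)
  show "finite (sym_perms n)" by (rule finite_sym_perms)
  show "sym_perms n \<noteq> {}" using id_in_sym_perms by blast
  show "(\<Sum>y\<in>sym_perms n. (shuffle_step n k ^^ t) (point_mass id) y) = 1"
    unfolding sum_shuffle_step_power[OF assms(1)]
    by (rule sum_point_mass[OF finite_sym_perms id_in_sym_perms])
  show "0 \<le> C / (1 + real t / (2 * real n))" using assms(2) by simp
  show "(1 - C / (1 + real t / (2 * real n))) / real (card (sym_perms n))
      \<le> (shuffle_step n k ^^ t) (point_mass id) y" if "y \<in> sym_perms n" for y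
    using shuffle_step_power_ge[OF assms, of y 0 t] that
    unfolding card_sym_perms by (simp add: sym_perms_def)
qed

text \<open>Until \<open>n\<close> is chosen as the top position for the first time, \<open>n\<close> is a fixed point.\<close>
lemma tv_dist_ge:
  assumes "n \<ge> 1"
  shows "(1 - 1 / real n) ^ t - 1 / real n \<le> tv_dist n k t"
proof -
  define A where "A = {y \<in> sym_perms n. y n = n}"
  have finA: "finite A" "A \<subseteq> sym_perms n" using finite_sym_perms by (auto simp: A_def)
  \<comment> \<open>A copy of the symmetric group on \<open>n - 1\<close> points, hence of uniform
    mass \<open>1 / n\<close>.\<close>
  have "A = {y. y permutes {1..n - 1}}"
  proof -
    have "y permutes {1..n - 1}" if "y permutes {1..n}" "y n = n" for y
    proof (rule permutes_superset[OF that(1)])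
      fix x assume "x \<in> {1..n} - {1..n - 1}"
      then have "x = n" by auto
      then show "y x = x" using that(2) by simp
    qed
    moreover have "y permutes {1..n} \<and> y n = n" if "y permutes {1..n - 1}" for y
      using permutes_subset[OF that, of "{1..n}"] permutes_not_in[OF that, of n] assms by auto
    ultimately show ?thesis by (auto simp: A_def sym_perms_def)
  qed
  then have "real (card A) = fact (n - 1)" by (simp add: card_permutations)
  moreover have "real (card (sym_perms n)) = real n * fact (n - 1)"
    using assms by (simp add: card_sym_perms fact_reduce)
  ultimately have unif: "(\<Sum>y\<in>A. 1 / real (card (sym_perms n))) = 1 / real n" by simp
  have "id \<in> A" using id_in_sym_perms by (simp add: A_def)
  then have "(1 - 1 / real n) ^ t \<le> (\<Sum>y\<in>A. (shuffle_step n k ^^ t) (point_mass id) y)"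
    using sum_fixing_shuffle_step_power_ge[OF assms, of "point_mass id" t k] sum_point_mass[OF finA(1)]
    by (simp add: A_def point_mass_def)
  moreover have "(\<Sum>y\<in>A. (shuffle_step n k ^^ t) (point_mass id) y) - (\<Sum>y\<in>A. 1 / real (card (sym_perms n)))
      \<le> tv_dist n k t"
    unfolding tv_dist_eq
  proof (rule half_l1_dist_ge[OF finite_sym_perms finA(2)])
    show "(\<Sum>y\<in>sym_perms n. (shuffle_step n k ^^ t) (point_mass id) y)
        = (\<Sum>y\<in>sym_perms n. 1 / real (card (sym_perms n)))"
      unfolding sum_shuffle_step_power[OF assms] sum_point_mass[OF finite_sym_perms id_in_sym_perms]
      by (simp add: card_sym_perms)
  qed
  ultimately show ?thesis using unif by linarith
qed

text \<open>Follows from \<open>ln (1 - x) \<ge> - x - 2 x^2 \<ge> - 2 x\<close> for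
  \<open>0 < x \<le> 1/2\<close>.\<close>

lemma exp_le_one_minus_inverse_power:
  assumes "n \<ge> 2"
  shows "exp (- 2 * real t / real n) \<le> (1 - 1 / real n) ^ t"
proof -
  define x where "x = 1 / real n"
  have x: "0 < x" "x \<le> 1/2" using assms by (auto simp: x_def field_simps)
  have "x\<^sup>2 \<le> x * (1/2)" unfolding power2_eq_square using x by (intro mult_left_mono) auto
  then have "- 2 * x \<le> ln (1 - x)"
    using ln_one_minus_pos_lower_bound[of x] x by linarith
  then have "exp (- 2 * x) \<le> 1 - x" using x by (simp add: ln_ge_iff)
  then have "exp (- 2 * x) ^ t \<le> (1 - x) ^ t" by (intro power_mono) auto
  then show ?thesis by (simp add: x_def mult.commute flip: exp_of_nat_mult)
qed

text \<open>All that the conclusion needs to know about the chain: up to an error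
  \<open>1 / n\<close>, both bounds depend on time only through \<open>t / n\<close>.\<close>

lemma shuffle_tv_bounds:
  fixes k :: "nat \<Rightarrow> nat"
  assumes "(\<lambda>n. real (k n)) \<in> \<Omega>(\<lambda>n. real n * ln (real n))"
  shows "\<exists>C>0. \<forall>\<^sub>F n in sequentially. \<forall>t.
    exp (- 2 * real t / real n) - 1 / real n \<le> tv_dist n (k n) t \<and>
    tv_dist n (k n) t \<le> C / (1 + real t / (2 * real n))"
proof -
  from assms obtain c where c: "c > 0"
    and ev: "\<forall>\<^sub>F n in sequentially. norm (real (k n)) \<ge> c * norm (real n * ln (real n))"
    by (elim landau_omega.bigE)
  \<comment> \<open>The value \<open>1\<close> serves \<open>l = 0\<close>. For
    \<open>l \<ge> 1\<close>, Markov's bound gives \<open>4 / (c l)\<close>, and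
    \<open>l + 1 \<le> 2 l\<close> turns it into \<open>(8 / c) / (l + 1)\<close>.\<close>
  define C where "C = max 1 (8 / c)"
  have "\<forall>\<^sub>F n in sequentially. \<forall>t.
    exp (- 2 * real t / real n) - 1 / real n \<le> tv_dist n (k n) t \<and>
    tv_dist n (k n) t \<le> C / (1 + real t / (2 * real n))"
    using ev eventually_ge_at_top[of 3]
  proof eventually_elim
    case (elim n)
    \<comment> \<open>From \<open>n \<ge> 3\<close> on, \<open>ln n \<ge> 1\<close>, which absorbs
      the constant in \<open>1 + ln n\<close>.\<close>
    have "exp 1 \<le> real n" using exp_le elim(2) by linarith
    then have ln: "1 \<le> ln (real n)" using elim(2) by (simp add: ln_ge_iff)
    have "c * (real n * ln (real n)) \<le> real (k n)" using elim ln by simp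
    then have kbound: "real n * ln (real n) \<le> real (k n) / c" using c by (simp add: field_simps)
    have "0 < real n * ln (real n)" using ln elim(2) by (intro mult_pos_pos) auto
    then have "0 < real (k n) / c" using kbound by linarith
    then have k0: "real (k n) > 0" using c by (simp add: zero_less_divide_iff)
    have "unmixed (k n * l) n True 1 \<le> C / (real l + 1)" for l
    proof (cases "l = 0")
      case True
      have "0 \<le> C" by (simp add: C_def)
      with True show ?thesis by (simp add: C_def)
    next
      case False
      then have l: "real l \<ge> 1" by simp
      have "real (k n * l) * unmixed (k n * l) n True 1 \<le> 2 * real n * (1 + ln (real n))"
        using elim(2) by (intro unmixed_markov) simp
      also have "\<dots> \<le> 4 * (real n * ln (real n))"
        using mult_left_mono[OF ln, of "2 * real n"] by (simp add: algebra_simps)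
      also have "\<dots> \<le> 4 * (real (k n) / c)" using kbound by simp
      finally have "real (k n) * (real l * unmixed (k n * l) n True 1) \<le> real (k n) * (4 / c)"
        by (simp add: mult_ac)
      then have "real l * unmixed (k n * l) n True 1 \<le> 4 / c" using k0 by (simp only: mult_le_cancel_left_pos)
      then have "unmixed (k n * l) n True 1 \<le> 4 / c / real l"
        using l by (simp only: pos_le_divide_eq mult.commute)
      also have "\<dots> = 8 / c / (2 * real l)" by simp
      also have "\<dots> \<le> 8 / c / (real l + 1)" using l c by (intro divide_left_mono) auto
      also have "\<dots> \<le> C / (real l + 1)" by (intro divide_right_mono) (auto simp: C_def)
      finally show ?thesis .
    qed
    then show ?case
      using tv_dist_le[of n C "k n"] tv_dist_ge[of n _ "k n"] exp_le_one_minus_inverse_power[of n] elim(2)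
      by (force simp: C_def intro: order_trans[OF diff_right_mono])
  qed
  moreover have "C > 0" by (simp add: C_def)
  ultimately show ?thesis by blast
qed

section \<open>Mixing times and absence of cutoff\<close>

lemma eventually_inverse_of_nat_less:
  fixes e :: real
  assumes "e > 0"
  shows "\<forall>\<^sub>F n in sequentially. 1 / real n < e"
  using order_tendstoD(2)[OF lim_1_over_n assms] by simp

lemma least_time_bigtheta:
  fixes d :: "nat \<Rightarrow> nat \<Rightarrow> real"
  assumes C: "C > 0" and \<epsilon>: "0 < \<epsilon>" "\<epsilon> < 1"
    and bounds: "\<forall>\<^sub>F n in sequentially. \<forall>t.
      exp (- 2 * real t / real n) - 1 / real n \<le> d n t \<and> d n t \<le> C / (1 + real t / (2 * real n))"
  shows "(\<lambda>n. real (LEAST t. d n t \<le> \<epsilon>)) \<in> \<Theta>(\<lambda>n. real n)"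
proof -
  define T where "T n = (LEAST t. d n t \<le> \<epsilon>)" for n
  \<comment> \<open>The time at which \<open>C / (t / (2 n))\<close> has dropped to
    \<open>\<epsilon>\<close>.\<close>
  define t0 where "t0 n = nat \<lceil>2 * real n * C / \<epsilon>\<rceil>" for n
  \<comment> \<open>Chosen so that \<open>exp (- 2 * \<delta>)\<close> is the square root of
    \<open>\<epsilon>\<close>; its gap above \<open>\<epsilon>\<close> absorbs the error
    \<open>1 / n\<close>.\<close>
  define \<delta> where "\<delta> = - ln \<epsilon> / 4"
  have \<delta>: "\<delta> > 0" using \<epsilon> by (simp add: \<delta>_def)
  have gap: "exp (- 2 * \<delta>) - \<epsilon> > 0"
  proof -
    have "ln \<epsilon> < - 2 * \<delta>" using \<epsilon> by (simp add: \<delta>_def)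
    then have "exp (ln \<epsilon>) < exp (- 2 * \<delta>)" by (subst exp_less_cancel_iff)
    then show ?thesis using \<epsilon> by simp
  qed
  \<comment> \<open>Besides bounding the minimum, this ensures that it is attained.\<close>
  have hit: "\<forall>\<^sub>F n in sequentially. d n (t0 n) \<le> \<epsilon>"
    using bounds eventually_ge_at_top[of 1]
  proof eventually_elim
    case (elim n)
    have "2 * real n * C / \<epsilon> \<le> real (t0 n)" unfolding t0_def by (rule real_nat_ceiling_ge)
    then have "C / \<epsilon> \<le> real (t0 n) / (2 * real n)" using elim(2) \<epsilon> by (simp add: field_simps)
    then have "C / (1 + real (t0 n) / (2 * real n)) \<le> C / (C / \<epsilon>)"
      using C \<epsilon> by (intro divide_left_mono mult_pos_pos) (auto simp: add_pos_nonneg)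
    also have "\<dots> = \<epsilon>" using C by simp
    finally show ?case using elim(1) by (meson order_trans)
  qed
  have "T \<in> O(\<lambda>n. real n)"
  proof (rule bigoI)
    show "\<forall>\<^sub>F n in sequentially. norm (real (T n)) \<le> (2 * C / \<epsilon> + 1) * norm (real n)"
      using hit eventually_ge_at_top[of 1]
    proof eventually_elim
      case (elim n)
      have "T n \<le> t0 n" unfolding T_def using elim(1) by (rule Least_le)
      moreover have "real (t0 n) \<le> 2 * real n * C / \<epsilon> + 1"
      proof -
        have "0 \<le> 2 * real n * C / \<epsilon>" using C \<epsilon> by simp
        then show ?thesis
          using of_int_ceiling_le_add_one[of "2 * real n * C / \<epsilon>"] unfolding t0_def by simp
      qed
      moreover have "1 \<le> real n" using elim(2) by simp
      ultimately show ?case by (simp add: algebra_simps)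
    qed
  qed
  moreover have "T \<in> \<Omega>(\<lambda>n. real n)"
  proof (rule landau_omega.bigI[OF \<delta>])
    show "\<forall>\<^sub>F n in sequentially. \<delta> * norm (real n) \<le> norm (real (T n))"
      using hit bounds eventually_inverse_of_nat_less[OF gap] eventually_ge_at_top[of 1]
    proof eventually_elim
      case (elim n)
      have "d n (T n) \<le> \<epsilon>" unfolding T_def using elim(1) by (rule LeastI)
      then have less: "exp (- 2 * real (T n) / real n) < exp (- 2 * \<delta>)"
        using elim(2,3) by (smt (verit))
      then have "\<delta> < real (T n) / real n" by simp
      then show ?case using elim(4) by (simp add: field_simps)
    qed
  qed
  ultimately show ?thesis unfolding T_def by (intro bigthetaI)
qed

text \<open>The upper bound keeps the distance below \<open>1/2\<close> from a time of order \<open>n\<close> on, so a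
  cutoff time would be at most of order \<open>n\<close>; but then the lower bound keeps the distance away
  from \<open>0\<close> after the cutoff.\<close>
lemma not_exhibits_cutoff:
  fixes d :: "nat \<Rightarrow> nat \<Rightarrow> real"
  assumes C: "C > 0"
    and bounds: "\<forall>\<^sub>F n in sequentially. \<forall>t.
      exp (- 2 * real t / real n) - 1 / real n \<le> d n t \<and> d n t \<le> C / (1 + real t / (2 * real n))"
  shows "\<not> exhibits_cutoff d"
proof
  assume "exhibits_cutoff d"
  then obtain t w :: "nat \<Rightarrow> real" and f g :: "real \<Rightarrow> real"
    where nonneg: "\<And>n. t n \<ge> 0" "\<And>n. w n \<ge> 0" and small: "w \<in> o(t)"
    and f: "\<forall>\<^sub>F c in at_top. (\<lambda>n. d n (nat (round (t n - c * w n)))) \<longlonglongrightarrow> f c" "(f \<longlongrightarrow> 1) at_top"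
    and g: "\<forall>\<^sub>F c in at_top. (\<lambda>n. d n (nat (round (t n + c * w n)))) \<longlonglongrightarrow> g c" "(g \<longlongrightarrow> 0) at_top"
    unfolding exhibits_cutoff_def by blast
  \<comment> \<open>From time \<open>A n\<close> on, the upper bound is at most
    \<open>C / (2 C) = 1/2\<close>.\<close>
  define A where "A = 4 * C"
  \<comment> \<open>A time \<open>s < A n\<close> before the cutoff forces
    \<open>t \<le> 2 A n + 2\<close>; half of \<open>t\<close> for the window and \<open>1\<close>
    for rounding give \<open>3 A n + 4 \<le> (3 A + 4) n\<close> for the time after it.\<close>
  define e where "e = exp (- 2 * (3 * A + 4))"
  have e: "e > 0" by (simp add: e_def)
  have "\<forall>\<^sub>F c in at_top. c > 0 \<and> f c > 1/2 \<and> (\<lambda>n. d n (nat (round (t n - c * w n)))) \<longlonglongrightarrow> f c"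
    using eventually_gt_at_top[of 0] order_tendstoD(1)[OF f(2), of "1/2"] f(1)
    by (auto elim: eventually_elim2 simp: eventually_conj_iff)
  then obtain c where c: "c > 0" "f c > 1/2" "(\<lambda>n. d n (nat (round (t n - c * w n)))) \<longlonglongrightarrow> f c"
    using eventually_happens'[OF trivial_limit_at_top_linorder] by blast
  have "\<forall>\<^sub>F c in at_top. c > 0 \<and> g c < e / 2 \<and> (\<lambda>n. d n (nat (round (t n + c * w n)))) \<longlonglongrightarrow> g c"
    using eventually_gt_at_top[of 0] order_tendstoD(2)[OF g(2), of "e / 2"] g(1) e
    by (auto elim: eventually_elim2 simp: eventually_conj_iff)
  then obtain c' where c': "c' > 0" "g c' < e / 2" "(\<lambda>n. d n (nat (round (t n + c' * w n)))) \<longlonglongrightarrow> g c'"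
    using eventually_happens'[OF trivial_limit_at_top_linorder] by blast
  have window: "\<forall>\<^sub>F n in sequentially. b * w n \<le> t n / 2" if "b > 0" for b
  proof -
    have "\<forall>\<^sub>F n in sequentially. norm (w n) \<le> 1 / (2 * b) * norm (t n)"
      using landau_o.smallD[OF small, of "1 / (2 * b)"] that by simp
    then show ?thesis
    proof eventually_elim
      case (elim n)
      then show ?case using nonneg[of n] that by (simp add: field_simps)
    qed
  qed
  have "\<forall>\<^sub>F n in sequentially. e / 2 \<le> d n (nat (round (t n + c' * w n)))"
    using window[OF c(1)] window[OF c'(1)] order_tendstoD(1)[OF c(3,2)] bounds
      eventually_inverse_of_nat_less[OF half_gt_zero[OF e]] eventually_ge_at_top[of 1]
  proof eventually_elim
    case (elim n)
    define s where "s = nat (round (t n - c * w n))"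
    define s' where "s' = nat (round (t n + c' * w n))"
    have n: "real n \<ge> 1" using elim by simp
    have "real s < A * real n"
    proof (rule ccontr)
      assume "\<not> real s < A * real n"
      then have "2 * C \<le> real s / (2 * real n)" using n by (simp add: A_def field_simps)
      then have "C / (1 + real s / (2 * real n)) \<le> C / (2 * C)"
        using C by (intro divide_left_mono mult_pos_pos) auto
      also have "\<dots> = 1/2" using C by simp
      finally show False using elim unfolding s_def by (smt (verit))
    qed
    moreover have "t n - c * w n \<le> real s + 1"
      using of_int_round_ge[of "t n - c * w n"] unfolding s_def by linarith
    ultimately have "t n \<le> 2 * A * real n + 2" using elim by linarith
    moreover have "real s' \<le> t n + c' * w n + 1"
    proof -
      \<comment> \<open>Nonnegativity makes \<open>nat\<close> harmless for an upper bound; for the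
        lower bound on \<open>s\<close> above, truncation at \<open>0\<close> only helps.\<close>
      have "0 \<le> t n + c' * w n" using nonneg[of n] c'(1) by simp
      then show ?thesis using of_int_round_le[of "t n + c' * w n"] unfolding s'_def by linarith
    qed
    ultimately have "real s' \<le> (3 * A + 4) * real n" using elim n by (simp add: algebra_simps)
    then have "- 2 * (3 * A + 4) \<le> - 2 * real s' / real n" using n by (simp add: field_simps)
    then have "e \<le> exp (- 2 * real s' / real n)" unfolding e_def by (simp only: exp_le_cancel_iff)
    then show ?case using elim unfolding s'_def by (smt (verit) field_sum_of_halves)
  qed
  then have "e / 2 \<le> g c'" by (intro tendsto_lowerbound[OF c'(3)]) auto
  then show False using c'(2) by simp
qed

theorem mainTheorem7:
  fixes k :: "nat \<Rightarrow> nat"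
  assumes "(\<lambda>n. real (k n)) \<in> \<Omega>(\<lambda>n. real n * ln (real n))"
  shows "(\<forall>\<epsilon>::real. 0 < \<epsilon> \<and> \<epsilon> < 1 \<longrightarrow>
            (\<lambda>n. real (t_mix n (k n) \<epsilon>)) \<in> \<Theta>(\<lambda>n. real n)) \<and>
         \<not> exhibits_cutoff (\<lambda>n t. tv_dist n (k n) t)"
proof -
  obtain C where C: "C > 0" and bounds: "\<forall>\<^sub>F n in sequentially. \<forall>t.
      exp (- 2 * real t / real n) - 1 / real n \<le> tv_dist n (k n) t \<and>
      tv_dist n (k n) t \<le> C / (1 + real t / (2 * real n))"
    using shuffle_tv_bounds[OF assms] by blast
  show ?thesis
  proof (intro conjI allI impI)
    fix \<epsilon> :: real assume "0 < \<epsilon> \<and> \<epsilon> < 1"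
    then show "(\<lambda>n. real (t_mix n (k n) \<epsilon>)) \<in> \<Theta>(\<lambda>n. real n)"
      unfolding t_mix_def using least_time_bigtheta[OF C _ _ bounds] by simp
  next
    show "\<not> exhibits_cutoff (\<lambda>n t. tv_dist n (k n) t)"
      by (rule not_exhibits_cutoff[OF C bounds])
  qed
qed

end
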